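(* Let $M$ be a monoid defined by a monoid presentation $\langle A\mid R\rangle$. Then there is a one-to-one correspondence between the right congruences of $M$ and the standard complete word graphs over $A$ compatible with $R$. If $\rho$ is a right congruence on $M$ and $\Gamma$ is the corresponding word graph, then the right actions of $M$ on $M/\rho$ and on $\Gamma$ are isomorphic; and $\rho=((0)\pi_{\Gamma})\theta$, where $\theta:A^*\to M$ is the unique homomorphism with $\ker(\theta)=R^{\#}$ and $(0)\pi_{\Gamma}$ is the path relation on $\Gamma$ (at the node $0$).
   Context: Functions are written to the right of their arguments. $A=\{a_0<a_1<\dots<a_{k-1}\}$ is a linearly ordered alphabet, $A^*$ is the free monoid on $A$ with identity the empty word $\varepsilon$, and $R\subseteq A^*\times A^*$. $R^{\#}$ is the least 2-sided congruence on $A^*$ containing $R$; the monoid defined by $\langle A\mid R\rangle$ is $M\cong A^*/R^{\#}$, and $\theta:A^*\to M$ is the natural surjective homomorphism, with $\ker(\theta)=R^{\#}$. For $T\subseteq A^*\times A^*$ write $(T)\theta=\{((u)\theta,(v)\theta):(u,v)\in T\}$. A right congruence on $M$ is an equivalence relation $\rho$ on $M$ with $(xs,ys)\in\rho$ for all $(x,y)\in\rho$ and $s\in M$; $x/\rho$ denotes the class of $x$ and $M/\rho=\{x/\rho:x\in M\}$. A word graph over $A$ is a digraph $\Gamma=(V,E)$ with edges $E\subseteq V\times A\times V$; an edge $(\alpha,a,\beta)$ has source $\alpha$, label $a$ and target $\beta$. It is assumed that the node set of a word graph is $V=\{0,\ldots,n-1\}$ for some $n\geq 1$, so that $0$ is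 always a node; in the word graph of a right congruence $\rho$, the node $0$ corresponds to the class $1_M/\rho$ of the identity of $M$. A word graph is complete (respectively deterministic) if for every node $\alpha$ and every $a\in A$ there is at least (respectively at most) one edge with source $\alpha$ and label $a$. A path is labelled by the product of the labels of its edges, and the empty path at any node is labelled by $\varepsilon$. Write $\alpha\cdot u=\beta$ if $u\in A^*$ labels a path from $\alpha$ to $\beta$ (an $(\alpha,\beta)$-path), and $\alpha\cdot u=\bot$ (undefined) if $u$ labels no path with source $\alpha$. The path relation of $\Gamma$ is given by $(\alpha)\pi_\Gamma=\{(u,v)\in A^*\times A^*:\alpha\cdot u\neq\bot\text{ and }\alpha\cdot u=\alpha\cdot v\}$ for $\alpha\in V$. $\Gamma$ is compatible with $R$ if for all $(u,v)\in R$ and all $\alpha\in V$, $\alpha\cdot u=\alpha\cdot v$ whenever $\alpha\cdot u\neq\bot$ and $\alpha\cdot v\neq\bot$. In the short-lex order on $A^*$, $u<v$ if $|u|<|v|$, or $|u|=|v|$ and $u$ is strictly lexicographically smaller than $v$. For a node $\alpha$ reachable from $0$, $w_\alpha$ denotes the short-lex least word labelling a $(0,\alpha)$-path. A complete word graph $\Gamma=(V,E)$ over $A$ is standard if: $\Gamma$ is deterministic; every node is reachable from $0\in V=\{0,\ldots,|V|-1\}$; and for all $\alpha,\beta\in V$, $\alpha<\beta$ if and only if $w_\alpha<w_\beta$. The right action of $M$ on $M/\rho$ is $(x/\rho,y)\mapsto xy/\rho$. The right action of $M$ on (the nodes of) a complete deterministic word graph $\Gamma=(V,E)$ compatible with $R$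 is $(\alpha,(w)\theta)\mapsto\alpha\cdot w$ for $\alpha\in V$, $w\in A^*$. Two right actions of $M$ on sets $X_0$ and $X_1$ are isomorphic if there is a bijection $\lambda:X_0\to X_1$ commuting with the actions.
   Formalization: Word graphs may also have node set all of ℕ, since a right congruence of infinite index (e.g. equality on the free monoid on one letter) has no finite word graph; the same correspondence is also shown to restrict to finite-index right congruences and word graphs on {0,…,n−1}. *)

theory Defs
  imports "HOL-Algebra.Group"
begin

section \<open>Congruences and monoid presentations\<close>

definition right_congruence :: "('m, 'z) monoid_scheme \<Rightarrow> ('m \<times> 'm) set \<Rightarrow> bool" where
  "right_congruence M \<rho> \<longleftrightarrow>
     equiv (carrier M) \<rho> \<and>
     (\<forall>(x, y)\<in>\<rho>. \<forall>s\<in>carrier M. (x \<otimes>\<^bsub>M\<^esub> s, y \<otimes>\<^bsub>M\<^esub> s) \<in> \<rho>)"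

definition two_sided_congruence :: "('m, 'z) monoid_scheme \<Rightarrow> ('m \<times> 'm) set \<Rightarrow> bool" where
  "two_sided_congruence M \<rho> \<longleftrightarrow>
     right_congruence M \<rho> \<and>
     (\<forall>(x, y)\<in>\<rho>. \<forall>s\<in>carrier M. (s \<otimes>\<^bsub>M\<^esub> x, s \<otimes>\<^bsub>M\<^esub> y) \<in> \<rho>)"

definition free_monoid :: "'a set \<Rightarrow> 'a list monoid" where
  "free_monoid A = \<lparr>carrier = lists A, mult = (@), one = []\<rparr>"

definition generated_congruence :: "'a set \<Rightarrow> ('a list \<times> 'a list) set \<Rightarrow> ('a list \<times> 'a list) set" where
  "generated_congruence A R = \<Inter>{\<rho>. two_sided_congruence (free_monoid A) \<rho> \<and> R \<subseteq> \<rho>}"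

definition presented_monoid :: "'a set \<Rightarrow> ('a list \<times> 'a list) set \<Rightarrow> 'a list set monoid" where
  "presented_monoid A R =
     \<lparr>carrier = lists A // generated_congruence A R,
      mult = (\<lambda>X Y. \<Union>x\<in>X. \<Union>y\<in>Y. generated_congruence A R `` {x @ y}),
      one = generated_congruence A R `` {[]}\<rparr>"

definition monoid_hom :: "('m, 'y) monoid_scheme \<Rightarrow> ('n, 'z) monoid_scheme \<Rightarrow> ('m \<Rightarrow> 'n) \<Rightarrow> bool" where
  "monoid_hom M N h \<longleftrightarrow> h \<in> hom M N \<and> h \<one>\<^bsub>M\<^esub> = \<one>\<^bsub>N\<^esub>"

definition kernel_congruence :: "('m, 'z) monoid_scheme \<Rightarrow> ('m \<Rightarrow> 'n) \<Rightarrow> ('m \<times> 'm) set" where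
  "kernel_congruence M h = {(x, y). x \<in> carrier M \<and> y \<in> carrier M \<and> h x = h y}"


section \<open>Word graphs\<close>

record 'a word_graph =
  nodes :: "nat set"
  edges :: "(nat \<times> 'a \<times> nat) set"

text \<open>
  The node set is \<open>{0, \<dots>, n - 1}\<close> for some \<open>n \<ge> 1\<close>, or all of the natural numbers; the latter
  alternative is needed for right congruences with infinitely many classes, which have no finite
  word graph. Hence a word graph with \<open>finite (nodes \<Gamma>)\<close> has nodes \<open>{0, \<dots>, n - 1}\<close> with \<open>n \<ge> 1\<close>.
\<close>
definition word_graph :: "'a set \<Rightarrow> 'a word_graph \<Rightarrow> bool" where
  "word_graph A \<Gamma> \<longleftrightarrow>
     ((\<exists>n\<ge>1. nodes \<Gamma> = {..<n}) \<or> nodes \<Gamma> = UNIV) \<and>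
     edges \<Gamma> \<subseteq> nodes \<Gamma> \<times> A \<times> nodes \<Gamma>"

definition complete :: "'a set \<Rightarrow> 'a word_graph \<Rightarrow> bool" where
  "complete A \<Gamma> \<longleftrightarrow> (\<forall>\<alpha>\<in>nodes \<Gamma>. \<forall>a\<in>A. \<exists>\<beta>. (\<alpha>, a, \<beta>) \<in> edges \<Gamma>)"

definition deterministic :: "'a set \<Rightarrow> 'a word_graph \<Rightarrow> bool" where
  "deterministic A \<Gamma> \<longleftrightarrow>
     (\<forall>\<alpha>\<in>nodes \<Gamma>. \<forall>a\<in>A. \<forall>\<beta> \<beta>'. (\<alpha>, a, \<beta>) \<in> edges \<Gamma> \<longrightarrow> (\<alpha>, a, \<beta>') \<in> edges \<Gamma> \<longrightarrow> \<beta> = \<beta>')"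

text \<open>\<open>labels_path \<Gamma> \<alpha> w \<beta>\<close>: the word \<open>w\<close> labels an \<open>(\<alpha>, \<beta>)\<close>-path.\<close>
primrec labels_path :: "'a word_graph \<Rightarrow> nat \<Rightarrow> 'a list \<Rightarrow> nat \<Rightarrow> bool" where
  "labels_path \<Gamma> \<alpha> [] \<beta> \<longleftrightarrow> \<alpha> \<in> nodes \<Gamma> \<and> \<alpha> = \<beta>"
| "labels_path \<Gamma> \<alpha> (a # w) \<beta> \<longleftrightarrow> (\<exists>\<gamma>. (\<alpha>, a, \<gamma>) \<in> edges \<Gamma> \<and> labels_path \<Gamma> \<gamma> w \<beta>)"

text \<open>
  The partial operation \<open>\<alpha> \<cdot> w\<close>, with \<open>None\<close> for the undefined value. The target of the path is
  unique when the graph is deterministic, which is the only case in which it is used.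
\<close>
definition follow :: "'a word_graph \<Rightarrow> nat \<Rightarrow> 'a list \<Rightarrow> nat option" where
  "follow \<Gamma> \<alpha> w =
     (if \<exists>\<beta>. labels_path \<Gamma> \<alpha> w \<beta> then Some (THE \<beta>. labels_path \<Gamma> \<alpha> w \<beta>) else None)"

definition path_relation :: "'a set \<Rightarrow> 'a word_graph \<Rightarrow> nat \<Rightarrow> ('a list \<times> 'a list) set" where
  "path_relation A \<Gamma> \<alpha> =
     {(u, v). u \<in> lists A \<and> v \<in> lists A \<and> follow \<Gamma> \<alpha> u \<noteq> None \<and> follow \<Gamma> \<alpha> u = follow \<Gamma> \<alpha> v}"

definition compatible :: "('a list \<times> 'a list) set \<Rightarrow> 'a word_graph \<Rightarrow> bool" where
  "compatible R \<Gamma> \<longleftrightarrow>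
     (\<forall>(u, v)\<in>R. \<forall>\<alpha>\<in>nodes \<Gamma>.
        follow \<Gamma> \<alpha> u \<noteq> None \<longrightarrow> follow \<Gamma> \<alpha> v \<noteq> None \<longrightarrow> follow \<Gamma> \<alpha> u = follow \<Gamma> \<alpha> v)"

text \<open>The library order \<^const>\<open>lenlex\<close> compares lengths first, then lexicographically from the left.\<close>
definition shortlex_less :: "'a::linorder list \<Rightarrow> 'a list \<Rightarrow> bool" where
  "shortlex_less u v \<longleftrightarrow> (u, v) \<in> lenlex {(a, b). a < b}"

definition least_word :: "'a::linorder word_graph \<Rightarrow> nat \<Rightarrow> 'a list" where
  "least_word \<Gamma> \<alpha> =
     (THE w. labels_path \<Gamma> 0 w \<alpha> \<and> (\<forall>v. labels_path \<Gamma> 0 v \<alpha> \<longrightarrow> w = v \<or> shortlex_less w v))"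

definition standard_complete_word_graph :: "'a::linorder set \<Rightarrow> 'a word_graph \<Rightarrow> bool" where
  "standard_complete_word_graph A \<Gamma> \<longleftrightarrow>
     word_graph A \<Gamma> \<and> complete A \<Gamma> \<and> deterministic A \<Gamma> \<and>
     (\<forall>\<alpha>\<in>nodes \<Gamma>. \<exists>w. labels_path \<Gamma> 0 w \<alpha>) \<and>
     (\<forall>\<alpha>\<in>nodes \<Gamma>. \<forall>\<beta>\<in>nodes \<Gamma>.
        \<alpha> < \<beta> \<longleftrightarrow> shortlex_less (least_word \<Gamma> \<alpha>) (least_word \<Gamma> \<beta>))"


section \<open>Right actions\<close>

definition right_action :: "('m, 'z) monoid_scheme \<Rightarrow> 'x set \<Rightarrow> ('x \<Rightarrow> 'm \<Rightarrow> 'x) \<Rightarrow> bool" where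
  "right_action M X f \<longleftrightarrow>
     (\<forall>x\<in>X. \<forall>s\<in>carrier M. f x s \<in> X) \<and>
     (\<forall>x\<in>X. f x \<one>\<^bsub>M\<^esub> = x) \<and>
     (\<forall>x\<in>X. \<forall>s\<in>carrier M. \<forall>t\<in>carrier M. f (f x s) t = f x (s \<otimes>\<^bsub>M\<^esub> t))"

definition isomorphic_right_actions ::
  "('m, 'z) monoid_scheme \<Rightarrow> 'x set \<Rightarrow> ('x \<Rightarrow> 'm \<Rightarrow> 'x) \<Rightarrow> 'y set \<Rightarrow> ('y \<Rightarrow> 'm \<Rightarrow> 'y) \<Rightarrow> bool" where
  "isomorphic_right_actions M X f Y g \<longleftrightarrow>
     right_action M X f \<and> right_action M Y g \<and>
     (\<exists>l. bij_betw l X Y \<and> (\<forall>x\<in>X. \<forall>s\<in>carrier M. l (f x s) = g (l x) s))"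

text \<open>\<open>(x/\<rho>, y) \<mapsto> xy/\<rho>\<close>; the union is over a family of equal classes.\<close>
definition quotient_action :: "('m, 'z) monoid_scheme \<Rightarrow> ('m \<times> 'm) set \<Rightarrow> 'm set \<Rightarrow> 'm \<Rightarrow> 'm set" where
  "quotient_action M \<rho> X y = (\<Union>x\<in>X. \<rho> `` {x \<otimes>\<^bsub>M\<^esub> y})"

text \<open>\<open>(\<alpha>, (w)\<theta>) \<mapsto> \<alpha> \<cdot> w\<close> for words \<open>w\<close> over \<open>A\<close>.\<close>
definition word_graph_action :: "'a set \<Rightarrow> ('a list \<Rightarrow> 'm) \<Rightarrow> 'a word_graph \<Rightarrow> nat \<Rightarrow> 'm \<Rightarrow> nat" where
  "word_graph_action A \<theta> \<Gamma> \<alpha> s = (THE \<beta>. \<exists>w\<in>lists A. \<theta> w = s \<and> follow \<Gamma> \<alpha> w = Some \<beta>)"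

end

theory Submission
  imports Defs
begin

text \<open>
  Fix a right congruence \<open>K\<close> on the free monoid \<open>A*\<close>. A complete deterministic word graph in which
  every node is reachable from \<open>0\<close> is the same thing as such a \<open>K\<close> (two words are related when they
  lead from \<open>0\<close> to the same node, that is, \<open>K\<close> is the path relation at \<open>0\<close>) together with a choice
  of names for its classes. Standardness removes the choice: it forces the names to increase with
  the short-lex least words of the classes and to fill an initial segment of the naturals, so the
  name of a class must be the number of classes whose least word is smaller. This number is
  finite because a finite alphabet has only finitely many words below a given one. It is called
  \<^term>\<open>class_index K w\<close> below, and the lemmas \<open>class_index_unique\<close> and
  \<open>standard_graph_of_numbering_iff\<close> say that it is the only standard naming. Hence \<open>\<Gamma>\<close> is
  recovered from its path relation at \<open>0\<close>, and every right congruence of \<open>A*\<close> has a standard graph.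

  Relations of the presentation enter through \<open>compatible_graph_of_numbering_iff\<close>: since
  every node is \<open>0 \<cdot> x\<close> for some word \<open>x\<close>, compatibility says that \<open>0 \<cdot> xu = 0 \<cdot> xv\<close> for all
  relations \<open>(u, v)\<close> and words \<open>x\<close>. The pairs \<open>(u, v)\<close> with this property form a two-sided
  congruence, so compatibility amounts to \<open>K\<close> containing the congruence generated by \<open>R\<close>.
  Standard compatible graphs therefore correspond to the right congruences of \<open>A*\<close> that contain
  the kernel of \<open>\<theta>\<close> (\<open>bij_betw_path_relation\<close>), and these correspond, by taking images under
  \<open>\<theta>\<close>, to the right congruences of \<open>M\<close> (\<open>bij_betw_right_congruences_image\<close>). The composite sends
  \<open>\<Gamma>\<close> to the image of its path relation at \<open>0\<close>; the required map is its inverse.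

  The class of \<open>(w)\<theta>\<close> in \<open>M/\<rho>\<close> corresponds to the node \<open>0 \<cdot> w\<close>, and both actions append a word to
  \<open>w\<close>, so this is an isomorphism of actions (\<open>isomorphic_actions_of_word_graph\<close>). In particular
  \<open>M/\<rho>\<close> and the node set are finite together.
\<close>

section \<open>The short-lex order\<close>

lemma shortlex_less_irrefl: "\<not> shortlex_less u u"
  by (simp add: shortlex_less_def lenlex_irreflexive)

lemma shortlex_less_trans: "shortlex_less u v \<Longrightarrow> shortlex_less v w \<Longrightarrow> shortlex_less u w"
  unfolding shortlex_less_def by (rule lenlex_trans) (auto intro: transI)

lemma shortlex_less_linear: "shortlex_less u v \<or> u = v \<or> shortlex_less v u"
proof -
  have "total (lenlex {(a::'a::linorder, b). a < b})"
    by (rule total_lenlex) (auto simp: total_on_def)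
  then show ?thesis
    by (auto simp: shortlex_less_def total_on_def)
qed

lemma finite_shortlex_below:
  assumes "finite A"
  shows "finite {v \<in> lists A. v = u \<or> shortlex_less v u}"
  by (rule finite_subset[OF _ finite_lists_length_le[OF assms, of "length u"]])
    (auto simp: shortlex_less_def dest: lenlex_length)

text \<open>
  The order on all lists need not be well-founded, because the type of letters need not be
  well-ordered; over a finite alphabet the words below a given one form a finite set, and the
  least element is found there.
\<close>
lemma shortlex_least_exists:
  assumes "finite A" and "S \<subseteq> lists A" and "S \<noteq> {}"
  shows "\<exists>m\<in>S. \<forall>v\<in>S. v = m \<or> shortlex_less m v"
proof -
  obtain u where u: "u \<in> S"
    using assms(3) by blast
  define T where "T = {v \<in> S. v = u \<or> shortlex_less v u}"
  have "finite T"
    using finite_shortlex_below[OF assms(1), of u] assms(2) unfolding T_def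
    by (rule_tac finite_subset) auto
  moreover have "T \<noteq> {}"
    using u by (auto simp: T_def)
  moreover have "asymp_on T shortlex_less"
    by (auto intro!: asymp_onI dest: shortlex_less_trans simp: shortlex_less_irrefl)
  moreover have "transp_on T shortlex_less"
    by (auto intro!: transp_onI dest: shortlex_less_trans)
  ultimately obtain m where m: "m \<in> T" "\<And>v. v \<in> T \<Longrightarrow> v \<noteq> m \<Longrightarrow> \<not> shortlex_less v m"
    using Finite_Set.bex_min_element[of T shortlex_less] by blast
  have "v = m \<or> shortlex_less m v" if "v \<in> S" for v
    using m that shortlex_less_linear shortlex_less_trans unfolding T_def by blast
  then show ?thesis
    using m(1) by (auto simp: T_def)
qed

section \<open>Numbering the classes of a congruence by their least words\<close>

definition least_words :: "('a::linorder list \<times> 'a list) set \<Rightarrow> 'a list set" where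
  "least_words K = {w. (w, w) \<in> K \<and> (\<forall>v. (w, v) \<in> K \<longrightarrow> v = w \<or> shortlex_less w v)}"

text \<open>
  The classes that precede the class of \<open>w\<close> are counted by their least words. The condition
  ranges over the whole class of \<open>w\<close>, instead of mentioning its least word, so that the value
  visibly depends on the class only.
\<close>
definition class_index :: "('a::linorder list \<times> 'a list) set \<Rightarrow> 'a list \<Rightarrow> nat" where
  "class_index K w = card {v \<in> least_words K. \<forall>u. (w, u) \<in> K \<longrightarrow> shortlex_less v u}"

lemma inj_on_if_less_iff_shortlex_less:
  fixes g :: "'a::linorder list \<Rightarrow> nat"
  assumes "\<And>u v. u \<in> S \<Longrightarrow> v \<in> S \<Longrightarrow> g u < g v \<longleftrightarrow> shortlex_less u v"
  shows "inj_on g S"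
proof (rule inj_onI)
  fix u v assume "u \<in> S" "v \<in> S" "g u = g v"
  then have "\<not> shortlex_less u v" "\<not> shortlex_less v u"
    using assms[of u v] assms[of v u] by simp_all
  then show "u = v"
    using shortlex_less_linear by blast
qed

lemma least_word_in_class:
  assumes "finite A" and "equiv (lists A) K" and "w \<in> lists A"
  shows "\<exists>r\<in>least_words K. (w, r) \<in> K"
proof -
  have "K `` {w} \<subseteq> lists A" and "K `` {w} \<noteq> {}"
    using assms(2,3) by (auto simp: equiv_def refl_on_def)
  then obtain m where m: "(w, m) \<in> K" and least: "\<And>v. (w, v) \<in> K \<Longrightarrow> v = m \<or> shortlex_less m v"
    using shortlex_least_exists[OF assms(1), of "K `` {w}"] by blast
  have "sym K" "trans K"
    using assms(2) by (simp_all add: equiv_def)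
  then have "(m, m) \<in> K" and "\<And>v. (m, v) \<in> K \<Longrightarrow> (w, v) \<in> K"
    using m by (blast dest: symD transD)+
  then have "m \<in> least_words K"
    using least by (simp add: least_words_def)
  then show ?thesis
    using m by blast
qed

lemma class_index_cong:
  assumes "equiv (lists A) K" and "(u, v) \<in> K"
  shows "class_index K u = class_index K v"
proof -
  have "(u, x) \<in> K \<longleftrightarrow> (v, x) \<in> K" for x
    using assms unfolding equiv_def by (blast dest: symD transD)
  then show ?thesis
    by (simp add: class_index_def)
qed

lemma class_index_least_word:
  assumes "r \<in> least_words K"
  shows "class_index K r = card {v \<in> least_words K. shortlex_less v r}"
proof -
  have "{v \<in> least_words K. \<forall>u. (r, u) \<in> K \<longrightarrow> shortlex_less v u}
      = {v \<in> least_words K. shortlex_less v r}"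
    using assms shortlex_less_trans unfolding least_words_def by blast
  then show ?thesis
    by (simp add: class_index_def)
qed

lemma finite_least_words_below:
  assumes "finite A" and "equiv (lists A) K"
  shows "finite {v \<in> least_words K. shortlex_less v r}"
  using finite_shortlex_below[OF assms(1), of r] assms(2)
  by (rule_tac finite_subset) (auto simp: least_words_def equiv_def)

lemma class_index_less_iff:
  assumes "finite A" and "equiv (lists A) K" and "u \<in> least_words K" and "v \<in> least_words K"
  shows "class_index K u < class_index K v \<longleftrightarrow> shortlex_less u v"
proof -
  have less: "class_index K x < class_index K y"
    if "shortlex_less x y" "x \<in> least_words K" "y \<in> least_words K" for x y
  proof -
    have "{v \<in> least_words K. shortlex_less v x} \<subset> {v \<in> least_words K. shortlex_less v y}"
      using that shortlex_less_trans shortlex_less_irrefl by blast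
    then show ?thesis
      using that finite_least_words_below[OF assms(1,2)]
      by (simp add: class_index_least_word psubset_card_mono)
  qed
  show ?thesis
    using less assms(3,4) shortlex_less_linear[of u v] by (metis less_asym less_irrefl)
qed

lemma class_index_eq_iff:
  assumes "finite A" and "equiv (lists A) K" and "u \<in> lists A" and "v \<in> lists A"
  shows "class_index K u = class_index K v \<longleftrightarrow> (u, v) \<in> K"
proof
  assume eq: "class_index K u = class_index K v"
  obtain r s where rs: "r \<in> least_words K" "(u, r) \<in> K" "s \<in> least_words K" "(v, s) \<in> K"
    using least_word_in_class[OF assms(1,2)] assms(3,4) by meson
  then have "class_index K r = class_index K s"
    using eq class_index_cong[OF assms(2)] by metis
  then have "r = s"
    using class_index_less_iff[OF assms(1,2)] rs shortlex_less_linear[of r s] by (metis less_irrefl)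
  then show "(u, v) \<in> K"
    using rs assms(2) unfolding equiv_def by (blast dest: symD transD)
qed (rule class_index_cong[OF assms(2)])

text \<open>
  If \<open>r\<close> is the least word in the class of \<open>w\<close>, the least words below \<open>r\<close> have distinct indices
  smaller than the index of \<open>r\<close>. There are as many of them as there are smaller values, because
  the index of \<open>r\<close> counts them, so every smaller value is taken.
\<close>
lemma class_index_downward_closed:
  assumes "finite A" and "equiv (lists A) K" and "w \<in> lists A"
  shows "{..<class_index K w} \<subseteq> class_index K ` lists A"
proof -
  obtain r where r: "r \<in> least_words K" "(w, r) \<in> K"
    using least_word_in_class[OF assms] by blast
  let ?B = "{v \<in> least_words K. shortlex_less v r}"
  have "inj_on (class_index K) ?B"
    using class_index_less_iff[OF assms(1,2)] by (intro inj_on_if_less_iff_shortlex_less) simp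
  moreover have "class_index K ` ?B \<subseteq> {..<class_index K r}"
    using class_index_less_iff[OF assms(1,2)] r(1) by auto
  ultimately have "class_index K ` ?B = {..<class_index K r}"
    by (intro card_subset_eq) (auto simp: card_image class_index_least_word[OF r(1)])
  moreover have "?B \<subseteq> lists A"
    using assms(2) by (auto simp: least_words_def equiv_def)
  ultimately show ?thesis
    unfolding class_index_cong[OF assms(2) r(2)] by (metis (no_types) image_mono)
qed

text \<open>
  An order isomorphism from the least words onto an initial segment of the naturals sends each
  least word to the number of its predecessors.
\<close>
lemma class_index_unique:
  assumes "finite A" and K: "equiv (lists A) K"
    and ker: "\<And>u v. u \<in> lists A \<Longrightarrow> v \<in> lists A \<Longrightarrow> g u = g v \<longleftrightarrow> (u, v) \<in> K"
    and down: "\<And>u. u \<in> lists A \<Longrightarrow> {..<g u} \<subseteq> g ` lists A"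
    and mono: "\<And>u v. u \<in> least_words K \<Longrightarrow> v \<in> least_words K \<Longrightarrow> g u < g v \<longleftrightarrow> shortlex_less u v"
    and w: "w \<in> lists A"
  shows "g w = class_index K w"
proof -
  obtain r where r: "r \<in> least_words K" "(w, r) \<in> K"
    using least_word_in_class[OF assms(1,2) w] by blast
  have L: "least_words K \<subseteq> lists A"
    using K by (auto simp: least_words_def equiv_def)
  have gr: "g w = g r"
    using ker[OF w subsetD[OF L r(1)]] r(2) by simp
  let ?B = "{v \<in> least_words K. shortlex_less v r}"
  have "n \<in> g ` ?B" if n: "n < g r" for n
  proof -
    obtain u where u: "u \<in> lists A" "g u = n"
      using down[of r] n r(1) L by blast
    obtain s where s: "s \<in> least_words K" "(u, s) \<in> K"
      using least_word_in_class[OF assms(1,2) u(1)] by blast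
    have "g s = n"
      using ker[OF u(1) subsetD[OF L s(1)]] s(2) u(2) by simp
    then show ?thesis
      using mono[OF s(1) r(1)] n s(1) by blast
  qed
  moreover have "g ` ?B \<subseteq> {..<g r}"
    using mono r(1) by auto
  ultimately have "g ` ?B = {..<g r}"
    by blast
  moreover have "inj_on g ?B"
    using mono by (intro inj_on_if_less_iff_shortlex_less) simp
  ultimately have "card ?B = g r"
    by (metis card_image card_lessThan)
  then show ?thesis
    using gr class_index_least_word[OF r(1)] class_index_cong[OF K r(2)] by simp
qed

lemma class_index_Nil:
  assumes "equiv (lists A) K"
  shows "class_index K [] = 0"
proof -
  have "([], []) \<in> K"
    using assms by (auto simp: equiv_def refl_on_def)
  then have "[] \<in> least_words K"
    by (auto simp: least_words_def shortlex_less_def)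
  moreover have "\<not> shortlex_less v []" for v :: "'a list"
    by (simp add: shortlex_less_def)
  ultimately show ?thesis
    by (simp add: class_index_least_word)
qed

section \<open>Functions on words whose kernel is a right congruence\<close>

lemma right_congruence_free_monoid_iff:
  "right_congruence (free_monoid A) K \<longleftrightarrow>
     equiv (lists A) K \<and> (\<forall>u v w. (u, v) \<in> K \<longrightarrow> w \<in> lists A \<longrightarrow> (u @ w, v @ w) \<in> K)"
  by (auto simp: right_congruence_def free_monoid_def)

lemma kernel_free_monoid_iff:
  "(u, v) \<in> kernel_congruence (free_monoid A) g \<longleftrightarrow> u \<in> lists A \<and> v \<in> lists A \<and> g u = g v"
  by (simp add: kernel_congruence_def free_monoid_def)

lemma equiv_kernel: "equiv (carrier M) (kernel_congruence M h)"
  by (auto simp: equiv_def refl_on_def sym_def trans_def kernel_congruence_def)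

definition right_invariant :: "'a set \<Rightarrow> ('a list \<Rightarrow> nat) \<Rightarrow> bool" where
  "right_invariant A g \<longleftrightarrow> right_congruence (free_monoid A) (kernel_congruence (free_monoid A) g)"

lemma right_invariant_iff:
  "right_invariant A g \<longleftrightarrow>
     (\<forall>u\<in>lists A. \<forall>v\<in>lists A. \<forall>w\<in>lists A. g u = g v \<longrightarrow> g (u @ w) = g (v @ w))"
proof -
  have "equiv (lists A) (kernel_congruence (free_monoid A) g)"
    using equiv_kernel[of "free_monoid A" g] by (simp add: free_monoid_def)
  then show ?thesis
    unfolding right_invariant_def right_congruence_free_monoid_iff kernel_free_monoid_iff by auto
qed

section \<open>Word graphs as numberings of words\<close>

text \<open>
  The graph in which \<open>g w\<close> is the node reached from \<open>g []\<close> by the word \<open>w\<close>. For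
  \<^term>\<open>right_invariant A g\<close> the target of an edge does not depend on the word that represents
  its source.
\<close>
definition graph_of_numbering :: "'a set \<Rightarrow> ('a list \<Rightarrow> nat) \<Rightarrow> 'a word_graph" where
  "graph_of_numbering A g =
     \<lparr>nodes = g ` lists A, edges = (\<lambda>(u, a). (g u, a, g (u @ [a]))) ` (lists A \<times> A)\<rparr>"

lemma nodes_graph_of_numbering [simp]: "nodes (graph_of_numbering A g) = g ` lists A"
  by (simp add: graph_of_numbering_def)

lemma graph_of_numbering_cong:
  assumes "\<And>w. w \<in> lists A \<Longrightarrow> g w = h w"
  shows "graph_of_numbering A g = graph_of_numbering A h"
proof -
  have "(\<lambda>(u, a). (g u, a, g (u @ [a]))) ` (lists A \<times> A)
      = (\<lambda>(u, a). (h u, a, h (u @ [a]))) ` (lists A \<times> A)"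
    using assms by (intro image_cong refl) (simp add: mem_Times_iff split_beta)
  moreover have "g ` lists A = h ` lists A"
    using assms by (rule image_cong[OF refl])
  ultimately show ?thesis
    by (simp add: graph_of_numbering_def)
qed

lemma edge_graph_of_numbering_iff:
  assumes "right_invariant A g" and "u \<in> lists A"
  shows "(g u, a, \<beta>) \<in> edges (graph_of_numbering A g) \<longleftrightarrow> a \<in> A \<and> \<beta> = g (u @ [a])"
proof
  assume "(g u, a, \<beta>) \<in> edges (graph_of_numbering A g)"
  then obtain u' where u': "u' \<in> lists A" "g u' = g u" and a: "a \<in> A" and \<beta>: "\<beta> = g (u' @ [a])"
    by (force simp: graph_of_numbering_def)
  have "[a] \<in> lists A"
    using a by simp
  then show "a \<in> A \<and> \<beta> = g (u @ [a])"
    using assms u' a \<beta> unfolding right_invariant_iff by blast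
next
  assume "a \<in> A \<and> \<beta> = g (u @ [a])"
  then show "(g u, a, \<beta>) \<in> edges (graph_of_numbering A g)"
    using assms(2) by (force simp: graph_of_numbering_def)
qed

lemma labels_path_graph_of_numbering_iff:
  assumes "right_invariant A g" and "u \<in> lists A"
  shows "labels_path (graph_of_numbering A g) (g u) w \<beta> \<longleftrightarrow> w \<in> lists A \<and> \<beta> = g (u @ w)"
  using assms(2)
proof (induction w arbitrary: u)
  case Nil
  then show ?case by auto
next
  case (Cons a w)
  have "labels_path (graph_of_numbering A g) (g u) (a # w) \<beta> \<longleftrightarrow>
      a \<in> A \<and> labels_path (graph_of_numbering A g) (g (u @ [a])) w \<beta>"
    by (simp add: edge_graph_of_numbering_iff[OF assms(1) Cons.prems])
  then show ?case
    using Cons.IH[of "u @ [a]"] Cons.prems by auto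
qed

lemma follow_graph_of_numbering:
  assumes "right_invariant A g" and "u \<in> lists A"
  shows "follow (graph_of_numbering A g) (g u) w = (if w \<in> lists A then Some (g (u @ w)) else None)"
proof -
  have "labels_path (graph_of_numbering A g) (g u) w = (\<lambda>\<beta>. w \<in> lists A \<and> \<beta> = g (u @ w))"
    using labels_path_graph_of_numbering_iff[OF assms] by blast
  then show ?thesis
    by (simp add: follow_def)
qed

lemma path_relation_graph_of_numbering:
  assumes "right_invariant A g" and "g [] = 0"
  shows "path_relation A (graph_of_numbering A g) 0 = kernel_congruence (free_monoid A) g"
proof -
  have "follow (graph_of_numbering A g) 0 w = (if w \<in> lists A then Some (g w) else None)" for w
    using follow_graph_of_numbering[OF assms(1), of "[]" w] assms(2) by simp
  then show ?thesis
    by (auto simp: path_relation_def kernel_congruence_def free_monoid_def split: if_splits)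
qed

lemma least_word_graph_of_numbering:
  assumes "right_invariant A g" and "g [] = 0"
    and "w \<in> least_words (kernel_congruence (free_monoid A) g)"
  shows "least_word (graph_of_numbering A g) (g w) = w"
proof -
  have path: "labels_path (graph_of_numbering A g) 0 v \<beta> \<longleftrightarrow> v \<in> lists A \<and> \<beta> = g v" for v \<beta>
    using labels_path_graph_of_numbering_iff[OF assms(1), of "[]" v \<beta>] assms(2) by simp
  have w: "w \<in> lists A" "\<And>v. v \<in> lists A \<Longrightarrow> g w = g v \<Longrightarrow> v = w \<or> shortlex_less w v"
    using assms(3) unfolding least_words_def by (simp_all add: kernel_free_monoid_iff)
  show ?thesis
    unfolding least_word_def path
    by (rule the_equality) (use w shortlex_less_trans shortlex_less_irrefl in metis)+
qed

lemma initial_segment_iff: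
  fixes S :: "nat set"
  shows "(\<exists>n\<ge>1. S = {..<n}) \<or> S = UNIV \<longleftrightarrow> 0 \<in> S \<and> (\<forall>n\<in>S. {..<n} \<subseteq> S)"
proof
  assume *: "0 \<in> S \<and> (\<forall>n\<in>S. {..<n} \<subseteq> S)"
  show "(\<exists>n\<ge>1. S = {..<n}) \<or> S = UNIV"
  proof (cases "S = UNIV")
    case False
    define n where "n = (LEAST n. n \<notin> S)"
    have "n \<notin> S" "\<And>m. m < n \<Longrightarrow> m \<in> S"
      using False LeastI_ex[of "\<lambda>n. n \<notin> S"] not_less_Least unfolding n_def by blast+
    moreover have "m < n" if "m \<in> S" for m
      using * that \<open>n \<notin> S\<close> by (metis lessThan_iff linorder_neqE_nat subsetD)
    ultimately have "S = {..<n}" "n \<noteq> 0"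
      using * by (auto intro: gr0I)
    then have "S = {..<n} \<and> n \<ge> 1"
      by simp
    then show ?thesis by blast
  qed simp
qed auto

text \<open>
  A graph of a right invariant numbering with \<open>g [] = 0\<close> is complete, deterministic and reachable
  from \<open>0\<close>. What remains of standardness is that the image of \<open>g\<close> is an initial segment and that
  \<open>g\<close> is monotone on least words; exactly one function with the given kernel has both properties.
\<close>
lemma standard_graph_of_numbering_iff:
  assumes "finite A" and inv: "right_invariant A g" and g0: "g [] = 0"
  shows "standard_complete_word_graph A (graph_of_numbering A g) \<longleftrightarrow>
    (\<forall>w\<in>lists A. g w = class_index (kernel_congruence (free_monoid A) g) w)" (is "?S \<longleftrightarrow> ?C")
proof -
  let ?K = "kernel_congruence (free_monoid A) g" and ?G = "graph_of_numbering A g"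
  have K: "equiv (lists A) ?K"
    using inv by (simp add: right_invariant_def right_congruence_free_monoid_iff)
  have L: "least_words ?K \<subseteq> lists A"
    by (auto simp: least_words_def kernel_free_monoid_iff)
  have edges: "edges ?G \<subseteq> nodes ?G \<times> A \<times> nodes ?G"
    by (force simp: graph_of_numbering_def)
  have "complete A ?G" "deterministic A ?G"
    using edge_graph_of_numbering_iff[OF inv] by (auto simp: complete_def deterministic_def)
  moreover have "\<forall>\<alpha>\<in>nodes ?G. \<exists>w. labels_path ?G 0 w \<alpha>"
    using labels_path_graph_of_numbering_iff[OF inv, of "[]"] g0 by auto
  moreover have "word_graph A ?G \<longleftrightarrow> (\<forall>u\<in>lists A. {..<g u} \<subseteq> g ` lists A)"
  proof -
    have "0 \<in> g ` lists A"
      using g0 by (metis image_eqI lists.Nil)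
    then show ?thesis
      using edges unfolding word_graph_def initial_segment_iff by simp
  qed
  moreover have "(\<forall>\<alpha>\<in>nodes ?G. \<forall>\<beta>\<in>nodes ?G.
        \<alpha> < \<beta> \<longleftrightarrow> shortlex_less (least_word ?G \<alpha>) (least_word ?G \<beta>)) \<longleftrightarrow>
      (\<forall>u\<in>least_words ?K. \<forall>v\<in>least_words ?K. g u < g v \<longleftrightarrow> shortlex_less u v)"
  proof -
    have "nodes ?G = g ` least_words ?K"
    proof -
      have "g w \<in> g ` least_words ?K" if w: "w \<in> lists A" for w
        using least_word_in_class[OF assms(1) K w] by (auto simp: kernel_free_monoid_iff)
      then show ?thesis
        using L by auto
    qed
    then show ?thesis
      using least_word_graph_of_numbering[OF inv g0] by simp
  qed
  ultimately have S: "?S \<longleftrightarrow> (\<forall>u\<in>lists A. {..<g u} \<subseteq> g ` lists A) \<and>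
      (\<forall>u\<in>least_words ?K. \<forall>v\<in>least_words ?K. g u < g v \<longleftrightarrow> shortlex_less u v)"
    unfolding standard_complete_word_graph_def by blast
  show ?thesis
  proof
    assume ?S
    then have down: "\<And>u. u \<in> lists A \<Longrightarrow> {..<g u} \<subseteq> g ` lists A"
      and mono: "\<And>u v. u \<in> least_words ?K \<Longrightarrow> v \<in> least_words ?K \<Longrightarrow> g u < g v \<longleftrightarrow> shortlex_less u v"
      unfolding S by blast+
    show ?C
      using class_index_unique[OF assms(1) K _ down mono] kernel_free_monoid_iff[of _ _ A g] by blast
  next
    assume C: ?C
    then have "g ` lists A = class_index ?K ` lists A"
      by (intro image_cong) auto
    moreover have "g u < g v \<longleftrightarrow> shortlex_less u v"
      if "u \<in> least_words ?K" "v \<in> least_words ?K" for u v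
    proof -
      have "g u = class_index ?K u" "g v = class_index ?K v"
        using C L that by blast+
      then show ?thesis
        using class_index_less_iff[OF assms(1) K that] by simp
    qed
    ultimately show ?S
      unfolding S using C class_index_downward_closed[OF assms(1) K] by simp
  qed
qed

lemma labels_path_append:
  assumes "word_graph A \<Gamma>"
  shows "labels_path \<Gamma> \<alpha> (u @ w) \<beta> \<longleftrightarrow> (\<exists>\<gamma>. labels_path \<Gamma> \<alpha> u \<gamma> \<and> labels_path \<Gamma> \<gamma> w \<beta>)"
proof (induction u arbitrary: \<alpha>)
  case Nil
  have "\<gamma> \<in> nodes \<Gamma>" if "labels_path \<Gamma> \<gamma> w \<beta>" for \<gamma>
    using that assms by (cases w) (auto simp: word_graph_def)
  then show ?case by auto
qed auto

lemma labels_path_closed: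
  assumes "word_graph A \<Gamma>" and "labels_path \<Gamma> \<alpha> w \<beta>"
  shows "\<beta> \<in> nodes \<Gamma>" and "w \<in> lists A"
proof -
  have "\<beta> \<in> nodes \<Gamma> \<and> w \<in> lists A"
    using assms(2)
  proof (induction w arbitrary: \<alpha>)
    case (Cons a w)
    then show ?case
      using assms(1) unfolding word_graph_def by fastforce
  qed simp
  then show "\<beta> \<in> nodes \<Gamma>" "w \<in> lists A"
    by blast+
qed

lemma labels_path_ex1:
  assumes "word_graph A \<Gamma>" "complete A \<Gamma>" "deterministic A \<Gamma>"
    and "\<alpha> \<in> nodes \<Gamma>" and "w \<in> lists A"
  shows "\<exists>!\<beta>. labels_path \<Gamma> \<alpha> w \<beta>"
  using assms(4,5)
proof (induction w arbitrary: \<alpha>)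
  case (Cons a w)
  have a: "a \<in> A" and w: "w \<in> lists A"
    using Cons.prems by auto
  obtain \<gamma> where \<gamma>: "(\<alpha>, a, \<gamma>) \<in> edges \<Gamma>"
    using assms(2) Cons.prems(1) a unfolding complete_def by blast
  have uniq: "\<gamma>' = \<gamma>" if "(\<alpha>, a, \<gamma>') \<in> edges \<Gamma>" for \<gamma>'
    using assms(3) Cons.prems(1) a \<gamma> that unfolding deterministic_def by blast
  have "\<gamma> \<in> nodes \<Gamma>"
    using assms(1) \<gamma> unfolding word_graph_def by blast
  moreover have "labels_path \<Gamma> \<alpha> (a # w) \<beta> \<longleftrightarrow> labels_path \<Gamma> \<gamma> w \<beta>" for \<beta>
    unfolding labels_path.simps by (metis \<gamma> uniq)
  ultimately show ?case
    using Cons.IH[OF _ w] by simp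
qed auto

text \<open>The numbering is \<open>w \<mapsto> 0 \<cdot> w\<close>.\<close>
lemma standard_graph_is_graph_of_numbering:
  assumes "standard_complete_word_graph A \<Gamma>"
  obtains g where "\<Gamma> = graph_of_numbering A g" and "right_invariant A g" and "g [] = 0"
proof -
  define g where "g w = (THE \<beta>. labels_path \<Gamma> 0 w \<beta>)" for w
  have wg: "word_graph A \<Gamma>" and compl: "complete A \<Gamma>" and det: "deterministic A \<Gamma>"
    and reach: "\<And>\<alpha>. \<alpha> \<in> nodes \<Gamma> \<Longrightarrow> \<exists>w. labels_path \<Gamma> 0 w \<alpha>"
    using assms by (auto simp: standard_complete_word_graph_def)
  have zero: "0 \<in> nodes \<Gamma>"
    using wg unfolding word_graph_def initial_segment_iff by blast
  have path: "labels_path \<Gamma> 0 w (g w)" if "w \<in> lists A" for w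
    unfolding g_def by (rule theI'[OF labels_path_ex1[OF wg compl det zero that]])
  have path_unique: "\<beta> = g w" if "labels_path \<Gamma> 0 w \<beta>" for w \<beta>
    using labels_path_ex1[OF wg compl det zero] labels_path_closed(2)[OF wg that] path that by blast
  have append: "labels_path \<Gamma> (g u) w (g (u @ w))" if "u \<in> lists A" "w \<in> lists A" for u w
  proof -
    have "labels_path \<Gamma> 0 (u @ w) (g (u @ w))"
      using path that by simp
    then obtain \<gamma> where "labels_path \<Gamma> 0 u \<gamma>" "labels_path \<Gamma> \<gamma> w (g (u @ w))"
      using labels_path_append[OF wg] by blast
    then show ?thesis
      using path_unique by blast
  qed
  have nodes: "nodes \<Gamma> = g ` lists A"
  proof (intro subset_antisym subsetI)
    fix \<alpha> assume "\<alpha> \<in> nodes \<Gamma>"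
    then obtain w where w: "labels_path \<Gamma> 0 w \<alpha>"
      using reach by blast
    then show "\<alpha> \<in> g ` lists A"
      using labels_path_closed(2)[OF wg w] path_unique by blast
  next
    fix \<alpha> assume "\<alpha> \<in> g ` lists A"
    then show "\<alpha> \<in> nodes \<Gamma>"
      using labels_path_closed(1)[OF wg path] by blast
  qed
  have edge: "(g u, a, g (u @ [a])) \<in> edges \<Gamma>" if "u \<in> lists A" "a \<in> A" for u a
    using append[of u "[a]"] that by auto
  have "edges \<Gamma> = (\<lambda>(u, a). (g u, a, g (u @ [a]))) ` (lists A \<times> A)"
  proof (intro subset_antisym subsetI)
    fix e assume e: "e \<in> edges \<Gamma>"
    then obtain \<alpha> a \<beta> where e_eq: "e = (\<alpha>, a, \<beta>)" and \<alpha>: "\<alpha> \<in> nodes \<Gamma>" and a: "a \<in> A"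
      using wg unfolding word_graph_def by blast
    obtain u where u: "u \<in> lists A" "\<alpha> = g u"
      using nodes \<alpha> by blast
    have "\<beta> = g (u @ [a])"
      using e edge[OF u(1) a] det \<alpha> a unfolding deterministic_def e_eq u(2) by blast
    then show "e \<in> (\<lambda>(u, a). (g u, a, g (u @ [a]))) ` (lists A \<times> A)"
      unfolding e_eq u(2) using u(1) a by (intro image_eqI[of _ _ "(u, a)"]) auto
  next
    fix e assume "e \<in> (\<lambda>(u, a). (g u, a, g (u @ [a]))) ` (lists A \<times> A)"
    then show "e \<in> edges \<Gamma>"
      by (elim imageE SigmaE) (simp add: edge)
  qed
  then have "\<Gamma> = graph_of_numbering A g"
    using nodes by (simp add: graph_of_numbering_def)
  moreover have "right_invariant A g"
    unfolding right_invariant_iff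
  proof (intro ballI impI)
    fix u v w assume uvw: "u \<in> lists A" "v \<in> lists A" "w \<in> lists A" and "g u = g v"
    then have "labels_path \<Gamma> (g u) w (g (v @ w))"
      using append[of v w] by simp
    moreover have "labels_path \<Gamma> (g u) w (g (u @ w))"
      using append uvw by simp
    moreover have "g u \<in> nodes \<Gamma>"
      using nodes uvw(1) by blast
    ultimately show "g (u @ w) = g (v @ w)"
      using labels_path_ex1[OF wg compl det _ uvw(3)] by blast
  qed
  moreover have "g [] = 0"
    using path[of "[]"] by simp
  ultimately show ?thesis
    by (rule that)
qed


section \<open>Compatibility with the relations\<close>

lemma generated_congruence_least:
  assumes "two_sided_congruence (free_monoid A) \<sigma>" and "R \<subseteq> \<sigma>"
  shows "generated_congruence A R \<subseteq> \<sigma>"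
  using assms by (auto simp: generated_congruence_def)

lemma generated_congruence_left_multiple:
  assumes "(u, v) \<in> R" and "x \<in> lists A"
  shows "(x @ u, x @ v) \<in> generated_congruence A R"
proof -
  have "(x @ u, x @ v) \<in> \<sigma>" if "two_sided_congruence (free_monoid A) \<sigma>" "R \<subseteq> \<sigma>" for \<sigma>
    using that assms unfolding two_sided_congruence_def by (force simp: free_monoid_def)
  then show ?thesis
    by (auto simp: generated_congruence_def)
qed

text \<open>
  Quantifying over all nodes \<open>g x\<close> makes compatibility invariant under multiplying a relation on
  the left. Right invariance of \<open>g\<close> takes care of multiplication on the right, so the pairs that
  satisfy the compatibility condition form a two-sided congruence.
\<close>
lemma compatible_graph_of_numbering_iff:
  assumes R: "R \<subseteq> lists A \<times> lists A" and inv: "right_invariant A g"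
  shows "compatible R (graph_of_numbering A g) \<longleftrightarrow>
    generated_congruence A R \<subseteq> kernel_congruence (free_monoid A) g" (is "_ \<longleftrightarrow> ?R")
proof -
  have "compatible R (graph_of_numbering A g) \<longleftrightarrow>
      (\<forall>(u, v)\<in>R. \<forall>x\<in>lists A. g (x @ u) = g (x @ v))" (is "_ \<longleftrightarrow> ?M")
  proof -
    have "(follow (graph_of_numbering A g) (g x) u \<noteq> None \<longrightarrow>
        follow (graph_of_numbering A g) (g x) v \<noteq> None \<longrightarrow>
        follow (graph_of_numbering A g) (g x) u = follow (graph_of_numbering A g) (g x) v) \<longleftrightarrow>
        g (x @ u) = g (x @ v)"
      if "(u, v) \<in> R" "x \<in> lists A" for u v x
    proof -
      have "u \<in> lists A" "v \<in> lists A"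
        using R that(1) by blast+
      then show ?thesis
        by (simp only: follow_graph_of_numbering[OF inv that(2)]) simp
    qed
    then show ?thesis
      unfolding compatible_def nodes_graph_of_numbering ball_simps by fast
  qed
  also have "?M \<longleftrightarrow> ?R"
  proof
    assume M: ?M
    let ?\<sigma> = "{(u, v). u \<in> lists A \<and> v \<in> lists A \<and> (\<forall>x\<in>lists A. g (x @ u) = g (x @ v))}"
    have eq: "equiv (lists A) ?\<sigma>"
      by (auto simp: equiv_def refl_on_def sym_def trans_def)
    have right: "(u @ w, v @ w) \<in> ?\<sigma>" if "(u, v) \<in> ?\<sigma>" "w \<in> lists A" for u v w
    proof -
      have uv: "u \<in> lists A" "v \<in> lists A" "\<And>x. x \<in> lists A \<Longrightarrow> g (x @ u) = g (x @ v)"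
        using that(1) by blast+
      have "g ((x @ u) @ w) = g ((x @ v) @ w)" if x: "x \<in> lists A" for x
      proof -
        have "x @ u \<in> lists A" "x @ v \<in> lists A"
          using x uv(1,2) by simp_all
        then show ?thesis
          using inv \<open>w \<in> lists A\<close> uv(3)[OF x] unfolding right_invariant_iff by blast
      qed
      then show ?thesis
        using that(2) uv(1,2) by simp
    qed
    have left: "(w @ u, w @ v) \<in> ?\<sigma>" if "(u, v) \<in> ?\<sigma>" "w \<in> lists A" for u v w
    proof -
      have "g ((x @ w) @ u) = g ((x @ w) @ v)" if "x \<in> lists A" for x
      proof -
        have "x @ w \<in> lists A"
          using that \<open>w \<in> lists A\<close> by simp
        then show ?thesis
          using \<open>(u, v) \<in> ?\<sigma>\<close> by blast
      qed
      then show ?thesis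
        using that by simp
    qed
    have "two_sided_congruence (free_monoid A) ?\<sigma>"
      unfolding two_sided_congruence_def right_congruence_free_monoid_iff
      using eq right left by (simp add: free_monoid_def split_beta)
    moreover have "R \<subseteq> ?\<sigma>"
      using M R by blast
    ultimately have gen_sub: "generated_congruence A R \<subseteq> ?\<sigma>"
      by (rule generated_congruence_least)
    have sub_ker: "?\<sigma> \<subseteq> kernel_congruence (free_monoid A) g"
    proof -
      have "g u = g v" if "\<forall>x\<in>lists A. g (x @ u) = g (x @ v)" for u v
        using bspec[OF that, of "[]"] by simp
      then show ?thesis
        unfolding subset_iff split_paired_All mem_Collect_eq case_prod_conv kernel_free_monoid_iff
        by blast
    qed
    show ?R
      by (rule order_trans[OF gen_sub sub_ker])
  next
    assume sub: ?R
    have "g (x @ u) = g (x @ v)" if "(u, v) \<in> R" "x \<in> lists A" for u v x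
    proof -
      have "(x @ u, x @ v) \<in> kernel_congruence (free_monoid A) g"
        using generated_congruence_left_multiple[OF that] sub by (rule subsetD[rotated])
      then show ?thesis
        unfolding kernel_free_monoid_iff by blast
    qed
    then show ?M
      by blast
  qed
  finally show ?thesis .
qed

text \<open>
  For empty \<open>R\<close> this is the correspondence between the standard complete word graphs and all right
  congruences of the free monoid.
\<close>
lemma bij_betw_path_relation:
  assumes "finite A" and R: "R \<subseteq> lists A \<times> lists A"
  shows "bij_betw (\<lambda>\<Gamma>. path_relation A \<Gamma> 0)
    {\<Gamma>. standard_complete_word_graph A \<Gamma> \<and> compatible R \<Gamma>}
    {K. right_congruence (free_monoid A) K \<and> generated_congruence A R \<subseteq> K}"
proof (rule bij_betw_byWitness[where f' = "\<lambda>K. graph_of_numbering A (class_index K)"])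
  have graph: "graph_of_numbering A (class_index (path_relation A \<Gamma> 0)) = \<Gamma> \<and>
      right_congruence (free_monoid A) (path_relation A \<Gamma> 0) \<and>
      generated_congruence A R \<subseteq> path_relation A \<Gamma> 0"
    if \<Gamma>: "standard_complete_word_graph A \<Gamma>" "compatible R \<Gamma>" for \<Gamma>
  proof -
    obtain g where g: "\<Gamma> = graph_of_numbering A g" and inv: "right_invariant A g" and g0: "g [] = 0"
      using standard_graph_is_graph_of_numbering[OF \<Gamma>(1)] .
    have ker: "path_relation A \<Gamma> 0 = kernel_congruence (free_monoid A) g"
      unfolding g by (rule path_relation_graph_of_numbering[OF inv g0])
    have "\<forall>w\<in>lists A. g w = class_index (path_relation A \<Gamma> 0) w"
      using \<Gamma>(1) standard_graph_of_numbering_iff[OF assms(1) inv g0] unfolding ker by (simp add: g)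
    then have "graph_of_numbering A g = graph_of_numbering A (class_index (path_relation A \<Gamma> 0))"
      by (intro graph_of_numbering_cong) blast
    then show ?thesis
      using g \<Gamma>(2) inv compatible_graph_of_numbering_iff[OF R inv]
      unfolding ker right_invariant_def by simp
  qed
  have congruence: "path_relation A (graph_of_numbering A (class_index K)) 0 = K \<and>
      standard_complete_word_graph A (graph_of_numbering A (class_index K)) \<and>
      compatible R (graph_of_numbering A (class_index K))"
    if K: "right_congruence (free_monoid A) K" "generated_congruence A R \<subseteq> K" for K
  proof -
    have eq: "equiv (lists A) K"
      using K(1) by (simp add: right_congruence_free_monoid_iff)
    have ker: "kernel_congruence (free_monoid A) (class_index K) = K"
    proof -
      have "(u, v) \<in> kernel_congruence (free_monoid A) (class_index K) \<longleftrightarrow> (u, v) \<in> K" for u v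
        unfolding kernel_free_monoid_iff
        using class_index_eq_iff[OF assms(1) eq] equiv_type[OF eq] by blast
      then show ?thesis
        by (auto simp only: set_eq_iff split_paired_all)
    qed
    have inv: "right_invariant A (class_index K)"
      unfolding right_invariant_def ker by (rule K(1))
    show ?thesis
      using path_relation_graph_of_numbering[OF inv class_index_Nil[OF eq]]
        standard_graph_of_numbering_iff[OF assms(1) inv class_index_Nil[OF eq]]
        compatible_graph_of_numbering_iff[OF R inv] K(2) unfolding ker by simp
  qed
  show "\<forall>\<Gamma>\<in>{\<Gamma>. standard_complete_word_graph A \<Gamma> \<and> compatible R \<Gamma>}.
      graph_of_numbering A (class_index (path_relation A \<Gamma> 0)) = \<Gamma>"
    using graph by blast
  show "\<forall>K\<in>{K. right_congruence (free_monoid A) K \<and> generated_congruence A R \<subseteq> K}.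
      path_relation A (graph_of_numbering A (class_index K)) 0 = K"
    using congruence by blast
  show "(\<lambda>\<Gamma>. path_relation A \<Gamma> 0) ` {\<Gamma>. standard_complete_word_graph A \<Gamma> \<and> compatible R \<Gamma>}
      \<subseteq> {K. right_congruence (free_monoid A) K \<and> generated_congruence A R \<subseteq> K}"
    using graph by blast
  show "(\<lambda>K. graph_of_numbering A (class_index K)) `
        {K. right_congruence (free_monoid A) K \<and> generated_congruence A R \<subseteq> K}
      \<subseteq> {\<Gamma>. standard_complete_word_graph A \<Gamma> \<and> compatible R \<Gamma>}"
    using congruence by blast
qed

section \<open>Right congruences along a surjective homomorphism\<close>

text \<open>
  Since \<open>K\<close> contains the kernel, replacing \<open>u\<close> and \<open>v\<close> by other elements with the same images does
  not affect whether they are related.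
\<close>
lemma image_congruence_iff:
  assumes "equiv (carrier N) K" and "kernel_congruence N h \<subseteq> K"
    and "u \<in> carrier N" and "v \<in> carrier N"
  shows "(h u, h v) \<in> map_prod h h ` K \<longleftrightarrow> (u, v) \<in> K"
proof
  assume "(h u, h v) \<in> map_prod h h ` K"
  then obtain u' v' where uv': "(u', v') \<in> K" "h u = h u'" "h v = h v'"
    by auto
  then have "u' \<in> carrier N" "v' \<in> carrier N"
    using equiv_type[OF assms(1)] by blast+
  then have "(u, u') \<in> K" "(v', v) \<in> K"
    using assms(2-4) uv'(2,3) by (auto simp: kernel_congruence_def)
  then show "(u, v) \<in> K"
    using uv'(1) assms(1) unfolding equiv_def by (blast dest: transD)
qed force

text \<open>The correspondence theorem for right congruences; the inverse map takes preimages.\<close>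
lemma bij_betw_right_congruences_image:
  assumes hom: "h \<in> hom N M" and surj: "h ` carrier N = carrier M" 
    and mult: "\<And>u v. u \<in> carrier N \<Longrightarrow> v \<in> carrier N \<Longrightarrow> u \<otimes>\<^bsub>N\<^esub> v \<in> carrier N"
  shows "bij_betw (\<lambda>K. map_prod h h ` K)
    {K. right_congruence N K \<and> kernel_congruence N h \<subseteq> K} {\<rho>. right_congruence M \<rho>}"
proof (rule bij_betw_byWitness
    [where f' = "\<lambda>\<rho>. {(u, v). u \<in> carrier N \<and> v \<in> carrier N \<and> (h u, h v) \<in> \<rho>}"])
  let ?pull = "\<lambda>\<rho>. {(u, v). u \<in> carrier N \<and> v \<in> carrier N \<and> (h u, h v) \<in> \<rho>}"
  have h_mult: "h (u \<otimes>\<^bsub>N\<^esub> v) = h u \<otimes>\<^bsub>M\<^esub> h v" if "u \<in> carrier N" "v \<in> carrier N" for u v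
    using hom that by (simp add: hom_def)
  have h_closed: "h u \<in> carrier M" if "u \<in> carrier N" for u
    using surj that by blast
  show "\<forall>K\<in>{K. right_congruence N K \<and> kernel_congruence N h \<subseteq> K}. ?pull (map_prod h h ` K) = K"
  proof clarify
    fix K assume "right_congruence N K" and ker: "kernel_congruence N h \<subseteq> K"
    then have eq: "equiv (carrier N) K"
      by (simp add: right_congruence_def)
    show "?pull (map_prod h h ` K) = K"
    proof (rule subset_antisym; rule subsetI)
      fix p assume "p \<in> ?pull (map_prod h h ` K)"
      moreover obtain u v where p: "p = (u, v)"
        by (cases p)
      ultimately have "u \<in> carrier N" "v \<in> carrier N" "(h u, h v) \<in> map_prod h h ` K"
        unfolding p mem_Collect_eq case_prod_conv by blast+
      then show "p \<in> K"
        unfolding p by (rule_tac image_congruence_iff[OF eq ker, THEN iffD1])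
    next
      fix p assume "p \<in> K"
      then show "p \<in> ?pull (map_prod h h ` K)"
        using equiv_type[OF eq] by (cases p) force
    qed
  qed
  show "\<forall>\<rho>\<in>{\<rho>. right_congruence M \<rho>}. map_prod h h ` ?pull \<rho> = \<rho>"
  proof clarify
    fix \<rho> assume "right_congruence M \<rho>"
    then have "\<rho> \<subseteq> h ` carrier N \<times> h ` carrier N"
      unfolding surj by (simp add: right_congruence_def equiv_type)
    then show "map_prod h h ` ?pull \<rho> = \<rho>"
      by force
  qed
  show "(\<lambda>K. map_prod h h ` K) ` {K. right_congruence N K \<and> kernel_congruence N h \<subseteq> K}
      \<subseteq> {\<rho>. right_congruence M \<rho>}"
  proof clarify
    fix K assume rc: "right_congruence N K" and ker: "kernel_congruence N h \<subseteq> K"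
    then have eq: "equiv (carrier N) K"
      by (simp add: right_congruence_def)
    note iff = image_congruence_iff[OF eq ker]
    let ?\<rho> = "map_prod h h ` K"
    have sub: "?\<rho> \<subseteq> carrier M \<times> carrier M"
      using equiv_type[OF eq] h_closed by auto
    have "refl_on (carrier M) ?\<rho>"
    proof (rule refl_onI)
      fix x assume "x \<in> carrier M"
      then obtain u where "u \<in> carrier N" "x = h u"
        using surj by blast
      then show "(x, x) \<in> ?\<rho>"
        using iff[of u u] eq by (simp add: equiv_def refl_on_def)
    qed
    moreover have "sym ?\<rho>"
      using eq unfolding equiv_def by (auto intro!: symI dest: symD)
    moreover have "trans ?\<rho>"
    proof (rule transI)
      fix x y z assume xy: "(x, y) \<in> ?\<rho>" and yz: "(y, z) \<in> ?\<rho>"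
      have "x \<in> h ` carrier N" "y \<in> h ` carrier N" "z \<in> h ` carrier N"
        unfolding surj using subsetD[OF sub xy] subsetD[OF sub yz] by simp_all
      then obtain u v w
        where uvw: "u \<in> carrier N" "v \<in> carrier N" "w \<in> carrier N" "x = h u" "y = h v" "z = h w"
        by (elim imageE)
      then have "(u, v) \<in> K" "(v, w) \<in> K"
        using iff xy yz by simp_all
      then have "(u, w) \<in> K"
        using eq unfolding equiv_def by (blast dest: transD)
      then show "(x, z) \<in> ?\<rho>"
        using uvw iff by simp
    qed
    moreover have "(x \<otimes>\<^bsub>M\<^esub> s, y \<otimes>\<^bsub>M\<^esub> s) \<in> ?\<rho>"
      if xy: "(x, y) \<in> ?\<rho>" and s: "s \<in> carrier M" for x y s
    proof -
      obtain u v where uv: "(u, v) \<in> K" "x = h u" "y = h v"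
        using xy by auto
      obtain w where w: "w \<in> carrier N" "s = h w"
        using s surj by blast
      have "(u \<otimes>\<^bsub>N\<^esub> w, v \<otimes>\<^bsub>N\<^esub> w) \<in> K"
        using rc uv(1) w(1) unfolding right_congruence_def by blast
      moreover have "u \<in> carrier N" "v \<in> carrier N"
        using uv(1) equiv_type[OF eq] by blast+
      ultimately have "h (u \<otimes>\<^bsub>N\<^esub> w) = x \<otimes>\<^bsub>M\<^esub> s" "h (v \<otimes>\<^bsub>N\<^esub> w) = y \<otimes>\<^bsub>M\<^esub> s"
        using uv w h_mult by simp_all
      with \<open>(u \<otimes>\<^bsub>N\<^esub> w, v \<otimes>\<^bsub>N\<^esub> w) \<in> K\<close> show ?thesis
        by force
    qed
    ultimately show "right_congruence M ?\<rho>"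
      using sub unfolding right_congruence_def equiv_def by blast
  qed
  show "?pull ` {\<rho>. right_congruence M \<rho>} \<subseteq> {K. right_congruence N K \<and> kernel_congruence N h \<subseteq> K}"
  proof clarify
    fix \<rho> assume rc: "right_congruence M \<rho>"
    then have "refl_on (carrier M) \<rho>" "sym \<rho>" "trans \<rho>"
      by (simp_all add: right_congruence_def equiv_def)
    then have "equiv (carrier N) (?pull \<rho>)"
      using h_closed by (auto simp: equiv_def intro!: refl_onI symI transI dest: refl_onD symD transD)
    moreover have "kernel_congruence N h \<subseteq> ?pull \<rho>"
      using h_closed \<open>refl_on (carrier M) \<rho>\<close> by (auto simp: kernel_congruence_def refl_on_def)
    moreover have "(u \<otimes>\<^bsub>N\<^esub> w, v \<otimes>\<^bsub>N\<^esub> w) \<in> ?pull \<rho>" if "(u, v) \<in> ?pull \<rho>" "w \<in> carrier N" for u v w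
    proof -
      have uv: "u \<in> carrier N" "v \<in> carrier N" "(h u, h v) \<in> \<rho>"
        using that(1) by blast+
      have "(h u \<otimes>\<^bsub>M\<^esub> h w, h v \<otimes>\<^bsub>M\<^esub> h w) \<in> \<rho>"
        using rc uv(3) h_closed[OF that(2)] unfolding right_congruence_def by blast
      then show ?thesis
        using uv that(2) h_mult mult by simp
    qed
    ultimately show "right_congruence N (?pull \<rho>) \<and> kernel_congruence N h \<subseteq> ?pull \<rho>"
      unfolding right_congruence_def by blast
  qed
qed

section \<open>The right actions\<close>

lemma quotient_action_class:
  assumes "right_congruence M \<rho>" and "x \<in> carrier M" and "s \<in> carrier M"
  shows "quotient_action M \<rho> (\<rho> `` {x}) s = \<rho> `` {x \<otimes>\<^bsub>M\<^esub> s}"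
proof -
  have eq: "equiv (carrier M) \<rho>"
    using assms(1) by (simp add: right_congruence_def)
  have "\<rho> `` {y \<otimes>\<^bsub>M\<^esub> s} = \<rho> `` {x \<otimes>\<^bsub>M\<^esub> s}" if "y \<in> \<rho> `` {x}" for y
  proof -
    have "(x \<otimes>\<^bsub>M\<^esub> s, y \<otimes>\<^bsub>M\<^esub> s) \<in> \<rho>"
      using assms that unfolding right_congruence_def by blast
    then show ?thesis
      using equiv_class_eq[OF eq] by blast
  qed
  moreover have "x \<in> \<rho> `` {x}"
    using eq assms(2) by (rule equiv_class_self)
  ultimately show ?thesis
    unfolding quotient_action_def by blast
qed

lemma right_action_quotient:
  assumes "monoid M" and rc: "right_congruence M \<rho>"
  shows "right_action M (carrier M // \<rho>) (quotient_action M \<rho>)"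
proof -
  interpret monoid M by fact
  show ?thesis
    unfolding right_action_def
    by (auto elim!: quotientE intro!: quotientI simp: quotient_action_class[OF rc] m_assoc)
qed

text \<open>
  The action axioms transfer along an equivariant bijection, so the second operation is shown to
  be an action together with the isomorphism.
\<close>
lemma isomorphic_right_actions_if_bij_betw:
  assumes act: "right_action M X f" and bij: "bij_betw l X Y"
    and comm: "\<And>x s. x \<in> X \<Longrightarrow> s \<in> carrier M \<Longrightarrow> l (f x s) = g (l x) s"
    and mon: "monoid M"
  shows "isomorphic_right_actions M X f Y g"
proof -
  interpret monoid M by (rule mon)
  have Y: "Y = l ` X"
    using bij by (simp add: bij_betw_def)
  have f: "\<And>x s. x \<in> X \<Longrightarrow> s \<in> carrier M \<Longrightarrow> f x s \<in> X" "\<And>x. x \<in> X \<Longrightarrow> f x \<one>\<^bsub>M\<^esub> = x"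
    "\<And>x s t. x \<in> X \<Longrightarrow> s \<in> carrier M \<Longrightarrow> t \<in> carrier M \<Longrightarrow> f (f x s) t = f x (s \<otimes>\<^bsub>M\<^esub> t)"
    using act by (auto simp: right_action_def)
  have "right_action M Y g"
    unfolding right_action_def Y using f by (auto simp: comm[symmetric])
  then show ?thesis
    using act bij comm unfolding isomorphic_right_actions_def by blast
qed

text \<open>
  The isomorphism sends the class of \<open>(w)\<theta>\<close> to the node \<open>0 \<cdot> w\<close>. It is well defined and
  injective because \<open>\<rho>\<close> relates \<open>(u)\<theta>\<close> and \<open>(v)\<theta>\<close> exactly if \<open>0 \<cdot> u = 0 \<cdot> v\<close>, and surjective
  because all nodes are reachable. The action on nodes is well defined because compatibility
  puts the kernel of \<open>\<theta>\<close> inside the path relation at \<open>0\<close>.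
\<close>
lemma isomorphic_actions_of_word_graph:
  assumes "monoid M" and R: "R \<subseteq> lists A \<times> lists A"
    and hom: "\<theta> \<in> hom (free_monoid A) M" and surj: "\<theta> ` lists A = carrier M"
    and ker: "kernel_congruence (free_monoid A) \<theta> = generated_congruence A R"
    and \<Gamma>: "standard_complete_word_graph A \<Gamma>" "compatible R \<Gamma>"
    and \<rho>: "\<rho> = map_prod \<theta> \<theta> ` path_relation A \<Gamma> 0" "right_congruence M \<rho>"
  shows "isomorphic_right_actions M (carrier M // \<rho>) (quotient_action M \<rho>)
    (nodes \<Gamma>) (word_graph_action A \<theta> \<Gamma>)"
proof -
  obtain g where g: "\<Gamma> = graph_of_numbering A g" and inv: "right_invariant A g" and g0: "g [] = 0"
    using standard_graph_is_graph_of_numbering[OF \<Gamma>(1)] .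
  let ?K = "kernel_congruence (free_monoid A) g"
  have \<rho>_image: "\<rho> = map_prod \<theta> \<theta> ` ?K"
    using \<rho>(1) path_relation_graph_of_numbering[OF inv g0] unfolding g by simp
  have kerg: "kernel_congruence (free_monoid A) \<theta> \<subseteq> ?K"
    using \<Gamma>(2) compatible_graph_of_numbering_iff[OF R inv] unfolding g ker by simp
  have class_iff: "(\<theta> u, \<theta> v) \<in> \<rho> \<longleftrightarrow> g u = g v" if "u \<in> lists A" "v \<in> lists A" for u v
    using image_congruence_iff[OF equiv_kernel kerg, of u v] kernel_free_monoid_iff[of u v A g] that
    unfolding \<rho>_image by (simp add: free_monoid_def)
  have eq: "equiv (carrier M) \<rho>"
    using \<rho>(2) by (simp add: right_congruence_def)
  have closed: "\<theta> u \<in> carrier M" if "u \<in> lists A" for u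
    using surj that by blast
  have mult: "\<theta> u \<otimes>\<^bsub>M\<^esub> \<theta> v = \<theta> (u @ v)" if "u \<in> lists A" "v \<in> lists A" for u v
    using hom that by (simp add: hom_def free_monoid_def)
  \<comment> \<open>The node of a class is read off from an arbitrary word that represents the class.\<close>
  define l where "l X = g (SOME u. u \<in> lists A \<and> \<rho> `` {\<theta> u} = X)" for X
  have l: "l (\<rho> `` {\<theta> u}) = g u" if u: "u \<in> lists A" for u
  proof -
    define v where "v = (SOME v. v \<in> lists A \<and> \<rho> `` {\<theta> v} = \<rho> `` {\<theta> u})"
    have v: "v \<in> lists A \<and> \<rho> `` {\<theta> v} = \<rho> `` {\<theta> u}"
      unfolding v_def using u by (rule_tac someI[of _ u]) simp
    then have "(\<theta> v, \<theta> u) \<in> \<rho>"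
      using eq_equiv_class_iff[OF eq] closed u by blast
    then show ?thesis
      using class_iff[of v u] v u unfolding l_def v_def by simp
  qed
  have quot: "carrier M // \<rho> = (\<lambda>u. \<rho> `` {\<theta> u}) ` lists A"
    unfolding quotient_def surj[symmetric] by blast
  have bij: "bij_betw l (carrier M // \<rho>) (nodes \<Gamma>)"
  proof (rule bij_betw_imageI)
    show "inj_on l (carrier M // \<rho>)"
    proof (rule inj_onI)
      fix X Y assume "X \<in> carrier M // \<rho>" "Y \<in> carrier M // \<rho>" and lXY: "l X = l Y"
      then obtain u v where uv: "u \<in> lists A" "v \<in> lists A" "X = \<rho> `` {\<theta> u}" "Y = \<rho> `` {\<theta> v}"
        unfolding quot by blast
      then have "(\<theta> u, \<theta> v) \<in> \<rho>"
        using lXY l class_iff by simp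
      then show "X = Y"
        using equiv_class_eq[OF eq] uv by simp
    qed
    show "l ` (carrier M // \<rho>) = nodes \<Gamma>"
      unfolding quot g nodes_graph_of_numbering image_image using l by (rule image_cong[OF refl])
  qed
  have action: "word_graph_action A \<theta> \<Gamma> (g u) (\<theta> w) = g (u @ w)"
    if u: "u \<in> lists A" and w: "w \<in> lists A" for u w
    unfolding word_graph_action_def
  proof (rule the_equality)
    show "\<exists>w'\<in>lists A. \<theta> w' = \<theta> w \<and> follow \<Gamma> (g u) w' = Some (g (u @ w))"
      using w follow_graph_of_numbering[OF inv u, of w] unfolding g by auto
  next
    fix \<beta> assume "\<exists>w'\<in>lists A. \<theta> w' = \<theta> w \<and> follow \<Gamma> (g u) w' = Some \<beta>"
    then obtain w' where w': "w' \<in> lists A" "\<theta> w' = \<theta> w" "follow \<Gamma> (g u) w' = Some \<beta>"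
      by blast
    then have "\<beta> = g (u @ w')"
      using follow_graph_of_numbering[OF inv u, of w'] unfolding g by simp
    moreover have "\<theta> (u @ w') = \<theta> (u @ w)"
      using mult[OF u w] mult[OF u w'(1)] w'(2) by simp
    then have "g (u @ w') = g (u @ w)"
      using kerg kernel_free_monoid_iff[of "u @ w'" "u @ w" A \<theta>]
        kernel_free_monoid_iff[of "u @ w'" "u @ w" A g] u w w'(1) by auto
    ultimately show "\<beta> = g (u @ w)"
      by simp
  qed
  have "l (quotient_action M \<rho> X s) = word_graph_action A \<theta> \<Gamma> (l X) s"
    if X: "X \<in> carrier M // \<rho>" and s: "s \<in> carrier M" for X s
  proof -
    obtain u where u: "u \<in> lists A" "X = \<rho> `` {\<theta> u}"
      using X[unfolded quot] by blast
    obtain w where w: "w \<in> lists A" "s = \<theta> w"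
      using s[folded surj] by blast
    have uw: "u @ w \<in> lists A"
      using u(1) w(1) by simp
    show ?thesis
      using quotient_action_class[OF \<rho>(2) closed[OF u(1)] closed[OF w(1)]]
        action[OF u(1) w(1)] l[OF u(1)] l[OF uw] mult[OF u(1) w(1)] u(2) w(2) by simp
  qed
  then show ?thesis
    using isomorphic_right_actions_if_bij_betw[OF right_action_quotient[OF assms(1) \<rho>(2)] bij]
      assms(1) by simp
qed

theorem theorem3p7:
  fixes A :: "'a::linorder set"
    and R :: "('a list \<times> 'a list) set"
    and M :: "('m, 'z) monoid_scheme"
    and \<theta> :: "'a list \<Rightarrow> 'm"
  assumes "finite A"
    and "R \<subseteq> lists A \<times> lists A"
    and "monoid M"
    and "M \<cong> presented_monoid A R"
    and "monoid_hom (free_monoid A) M \<theta>"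
    and "\<theta> ` lists A = carrier M"
    and "kernel_congruence (free_monoid A) \<theta> = generated_congruence A R"
  shows "\<exists>\<Phi>.
     bij_betw \<Phi> {\<rho>. right_congruence M \<rho>}
       {\<Gamma>. standard_complete_word_graph A \<Gamma> \<and> compatible R \<Gamma>} \<and>
     bij_betw \<Phi> {\<rho>. right_congruence M \<rho> \<and> finite (carrier M // \<rho>)}
       {\<Gamma>. standard_complete_word_graph A \<Gamma> \<and> compatible R \<Gamma> \<and> finite (nodes \<Gamma>)} \<and>
     (\<forall>\<rho>. right_congruence M \<rho> \<longrightarrow>
        isomorphic_right_actions M
          (carrier M // \<rho>) (quotient_action M \<rho>)
          (nodes (\<Phi> \<rho>)) (word_graph_action A \<theta> (\<Phi> \<rho>)) \<and>
        \<rho> = map_prod \<theta> \<theta> ` path_relation A (\<Phi> \<rho>) 0)"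
proof -
  define graphs where "graphs = {\<Gamma>. standard_complete_word_graph A \<Gamma> \<and> compatible R \<Gamma>}"
  define \<Psi> where "\<Psi> \<Gamma> = map_prod \<theta> \<theta> ` path_relation A \<Gamma> 0" for \<Gamma>
  have hom: "\<theta> \<in> hom (free_monoid A) M"
    using assms(5) by (simp add: monoid_hom_def)
  have "bij_betw (\<lambda>K. map_prod \<theta> \<theta> ` K)
      {K. right_congruence (free_monoid A) K \<and> generated_congruence A R \<subseteq> K} {\<rho>. right_congruence M \<rho>}"
    using bij_betw_right_congruences_image[OF hom] assms(6) unfolding assms(7)
    by (simp add: free_monoid_def)
  then have bij: "bij_betw \<Psi> graphs {\<rho>. right_congruence M \<rho>}"
    using bij_betw_trans[OF bij_betw_path_relation[OF assms(1,2)]]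
    unfolding graphs_def \<Psi>_def[abs_def] comp_def by blast
  define \<Phi> where "\<Phi> = inv_into graphs \<Psi>"
  have bij_inv: "bij_betw \<Phi> {\<rho>. right_congruence M \<rho>} graphs"
    unfolding \<Phi>_def by (rule bij_betw_inv_into[OF bij])
  have \<Phi>: "\<Phi> \<rho> \<in> graphs" "\<rho> = \<Psi> (\<Phi> \<rho>)" if "right_congruence M \<rho>" for \<rho>
    using bij_betwE[OF bij_inv] bij_betw_inv_into_right[OF bij] that unfolding \<Phi>_def by auto
  have iso: "isomorphic_right_actions M (carrier M // \<rho>) (quotient_action M \<rho>)
      (nodes (\<Phi> \<rho>)) (word_graph_action A \<theta> (\<Phi> \<rho>))" if "right_congruence M \<rho>" for \<rho>
    using isomorphic_actions_of_word_graph[OF assms(3,2) hom assms(6,7)] \<Phi>[OF that] that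
    unfolding graphs_def \<Psi>_def by blast
  have "finite (nodes (\<Phi> \<rho>)) \<longleftrightarrow> finite (carrier M // \<rho>)" if "right_congruence M \<rho>" for \<rho>
    using iso[OF that] bij_betw_finite unfolding isomorphic_right_actions_def by blast
  then have "bij_betw \<Phi> {\<rho> \<in> {\<rho>. right_congruence M \<rho>}. finite (carrier M // \<rho>)}
      {\<Gamma> \<in> graphs. finite (nodes \<Gamma>)}"
    by (intro bij_betw_Collect[OF bij_inv]) simp
  then show ?thesis
    using bij_inv iso \<Phi>(2) unfolding graphs_def \<Psi>_def by (intro exI[of _ \<Phi>]) simp
qed

end
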